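(* Let $k$ be a commutative noetherian ring and let $R$ be an affine $k$-algebra. The family $$\mathcal{F} = \{I \text{ an ideal of } R : R/I \text{ is finitely generated as a } k\text{-module}\}$$ satisfies $(P_1)$. Thus any just infinite $k$-algebra is prime. Furthermore, if $R$ is not finitely generated as a $k$-module, then $R$ is just infinite over $k$ if and only if $R/P$ is finitely generated as a $k$-module for every nonzero prime ideal $P$ of $R$.
   Context: Rings and algebras are associative and unital, not necessarily commutative; "ideal" means two-sided ideal. A $k$-algebra is affine if it is finitely generated as a $k$-algebra. A $k$-algebra $R$ is just infinite if $R$ is not finitely generated as a $k$-module but $R/I$ is finitely generated as a $k$-module for every nonzero ideal $I$ of $R$. A family $\mathcal{F}$ of ideals of $R$ satisfies $(P_1)$ if $R\in\mathcal{F}$, $\mathcal{F}$ is closed under products ($I,J\in\mathcal{F}\Rightarrow IJ\in\mathcal{F}$), and $\mathcal{F}$ is upward closed ($I\in\mathcal{F}$ and $J\supseteq I$ an ideal imply $J\in\mathcal{F}$). *)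

theory Defs
  imports "HOL-Algebra.Algebra"
begin

text \<open>The library locale \<^locale>\<open>algebra\<close> only covers commutative algebras, so
  associative unital algebras over a commutative ring are introduced here, on the same
  \<open>module\<close> records. The zero ring is allowed.\<close>

locale assoc_algebra = module K R + ring R
  for K :: "('k, 'm) ring_scheme" and R :: "('k, 'r, 'n) module_scheme" (structure) +
  assumes smult_mult_left:
      "\<lbrakk>a \<in> carrier K; x \<in> carrier R; y \<in> carrier R\<rbrakk> \<Longrightarrow>
         (a \<odot> x) \<otimes> y = a \<odot> (x \<otimes> y)"
    and smult_mult_right:
      "\<lbrakk>a \<in> carrier K; x \<in> carrier R; y \<in> carrier R\<rbrakk> \<Longrightarrow>
         x \<otimes> (a \<odot> y) = a \<odot> (x \<otimes> y)"

text \<open>Generated submodules and subalgebras are hulls, in the style of \<^const>\<open>genideal\<close>.\<close>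

definition submodule_generated ::
    "('k, 'm) ring_scheme \<Rightarrow> ('k, 'r, 'n) module_scheme \<Rightarrow> 'r set \<Rightarrow> 'r set"
  where "submodule_generated K M B = \<Inter>{H. submodule H K M \<and> B \<subseteq> H}"

definition fg_module :: "('k, 'm) ring_scheme \<Rightarrow> ('k, 'r, 'n) module_scheme \<Rightarrow> bool"
  where "fg_module K M \<longleftrightarrow>
    (\<exists>B \<subseteq> carrier M. finite B \<and> submodule_generated K M B = carrier M)"

definition subalgebra_generated ::
    "('k, 'm) ring_scheme \<Rightarrow> ('k, 'r, 'n) module_scheme \<Rightarrow> 'r set \<Rightarrow> 'r set"
  where "subalgebra_generated K R B =
    \<Inter>{H. subring H R \<and> submodule H K R \<and> B \<subseteq> H}"

definition affine_algebra :: "('k, 'm) ring_scheme \<Rightarrow> ('k, 'r, 'n) module_scheme \<Rightarrow> bool"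
  where "affine_algebra K R \<longleftrightarrow> assoc_algebra K R \<and>
    (\<exists>B \<subseteq> carrier R. finite B \<and> subalgebra_generated K R B = carrier R)"

text \<open>The ring \<open>R Quot I\<close> with its induced scalar multiplication. The union has the same purpose
  as in \<^const>\<open>rcoset_mult\<close>: it avoids choosing a representative, and all its members agree
  when \<open>I\<close> is an ideal and \<open>C\<close> is one of its cosets.\<close>

definition quotient_algebra :: "('k, 'r, 'n) module_scheme \<Rightarrow> 'r set \<Rightarrow> ('k, 'r set) module"
  where "quotient_algebra R I =
    ring.extend (R Quot I) (module.fields (\<lambda>a C. \<Union>x\<in>C. I +>\<^bsub>R\<^esub> (a \<odot>\<^bsub>R\<^esub> x)))"

definition cofinite_ideals ::
    "('k, 'm) ring_scheme \<Rightarrow> ('k, 'r, 'n) module_scheme \<Rightarrow> 'r set set"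
  where "cofinite_ideals K R = {I. ideal I R \<and> fg_module K (quotient_algebra R I)}"

definition just_infinite :: "('k, 'm) ring_scheme \<Rightarrow> ('k, 'r, 'n) module_scheme \<Rightarrow> bool"
  where "just_infinite K R \<longleftrightarrow> assoc_algebra K R \<and> \<not> fg_module K R \<and>
    (\<forall>I. ideal I R \<and> I \<noteq> {\<zero>\<^bsub>R\<^esub>} \<longrightarrow> fg_module K (quotient_algebra R I))"

definition satisfies_P1 :: "('r, 'n) ring_scheme \<Rightarrow> 'r set set \<Rightarrow> bool"
  where "satisfies_P1 R F \<longleftrightarrow>
    (\<forall>I\<in>F. ideal I R) \<and>
    carrier R \<in> F \<and>
    (\<forall>I\<in>F. \<forall>J\<in>F. I \<cdot>\<^bsub>R\<^esub> J \<in> F) \<and>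
    (\<forall>I\<in>F. \<forall>J. ideal J R \<and> I \<subseteq> J \<longrightarrow> J \<in> F)"

text \<open>Prime ideals in the noncommutative sense, by products of ideals; the library's
  \<^locale>\<open>primeideal\<close> requires a commutative ring and is stated for elements.\<close>

definition nc_prime_ideal :: "'r set \<Rightarrow> ('r, 'n) ring_scheme \<Rightarrow> bool"
  where "nc_prime_ideal P R \<longleftrightarrow> ideal P R \<and> P \<noteq> carrier R \<and>
    (\<forall>I J. ideal I R \<and> ideal J R \<and> I \<cdot>\<^bsub>R\<^esub> J \<subseteq> P \<longrightarrow> I \<subseteq> P \<or> J \<subseteq> P)"

definition prime_ring :: "('r, 'n) ring_scheme \<Rightarrow> bool"
  where "prime_ring R \<longleftrightarrow> ring R \<and> nc_prime_ideal {\<zero>\<^bsub>R\<^esub>} R"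

lemma (in assoc_algebra) ideal_smult_closed:
  assumes I: "ideal I R" and a: "a \<in> carrier K" and x: "x \<in> I"
  shows "a \<odot> x \<in> I"
proof -
  have xc: "x \<in> carrier R" using ideal.Icarr[OF I x] .
  have "a \<odot> x = (a \<odot> \<one>) \<otimes> x" using a xc by (simp add: smult_mult_left)
  then show ?thesis using ideal.I_l_closed[OF I x, of "a \<odot> \<one>"] a by simp
qed

lemma (in assoc_algebra) quotient_smult:
  assumes I: "ideal I R" and a: "a \<in> carrier K" and x: "x \<in> carrier R"
  shows "a \<odot>\<^bsub>quotient_algebra R I\<^esub> (I +> x) = I +> (a \<odot> x)"
proof -
  interpret I: ideal I R by (rule I)
  have eq: "I +> (a \<odot> y) = I +> (a \<odot> x)" if "y \<in> I +> x" for y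
  proof -
    from that obtain h where h: "h \<in> I" "y = h \<oplus> x" by (auto simp: a_r_coset_def')
    have hc: "h \<in> carrier R" using h(1) by (rule I.Icarr)
    have "a \<odot> y = a \<odot> h \<oplus> a \<odot> x" using h hc a x by (simp add: smult_r_distr)
    then have "a \<odot> y \<in> I +> (a \<odot> x)"
      using ideal_smult_closed[OF I a h(1)] by (auto simp: a_r_coset_def')
    then show ?thesis using I.a_repr_independence'[of "a \<odot> y" "a \<odot> x"] a x by simp
  qed
  have "x \<in> I +> x" using I.a_rcos_self[OF x] .
  then have "(\<Union>y\<in>I +> x. I +> (a \<odot> y)) = I +> (a \<odot> x)"
    using eq by blast
  then show ?thesis by (simp add: quotient_algebra_def ring.defs module.defs)
qed

lemma (in assoc_algebra) quotient_assoc_algebra: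
  assumes I: "ideal I R"
  shows "assoc_algebra K (quotient_algebra R I)"
proof -
  let ?Q = "quotient_algebra R I"
  interpret I: ideal I R by (rule I)
  interpret Q: ring "R Quot I" by (rule I.quotient_is_ring)
  have sel: "carrier ?Q = carrier (R Quot I)" "monoid.mult ?Q = monoid.mult (R Quot I)"
    "one ?Q = one (R Quot I)" "ring.zero ?Q = ring.zero (R Quot I)" "ring.add ?Q = ring.add (R Quot I)"
    by (simp_all add: quotient_algebra_def ring.defs module.defs)
  have ringQ: "ring ?Q"
  proof (intro ringI abelian_groupI monoidI, unfold sel)
    show "\<exists>y\<in>carrier (R Quot I). y \<oplus>\<^bsub>R Quot I\<^esub> x = \<zero>\<^bsub>R Quot I\<^esub>"
      if "x \<in> carrier (R Quot I)" for x
      using that Q.a_inv_closed Q.l_neg by blast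
  qed (simp_all add: Q.add.m_ac Q.m_assoc Q.l_distr Q.r_distr)
  have rep: "\<exists>x\<in>carrier R. C = I +> x" if "C \<in> carrier ?Q" for C
    using that by (auto simp: sel FactRing_def A_RCOSETS_def')
  have mem: "I +> x \<in> carrier ?Q" if "x \<in> carrier R" for x
    using that by (auto simp: sel FactRing_def A_RCOSETS_def')
  have add: "(I +> x) \<oplus>\<^bsub>?Q\<^esub> (I +> y) = I +> (x \<oplus> y)" if "x \<in> carrier R" "y \<in> carrier R" for x y
    using that I.a_rcos_sum by (simp add: sel FactRing_def)
  have mul: "(I +> x) \<otimes>\<^bsub>?Q\<^esub> (I +> y) = I +> (x \<otimes> y)" if "x \<in> carrier R" "y \<in> carrier R" for x y
    using that I.rcoset_mult_add by (simp add: sel FactRing_def)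
  note sm = quotient_smult[OF I]
  have "module K ?Q"
  proof (rule moduleI)
    show "cring K" by (rule R.is_cring)
    show "abelian_group ?Q" using ringQ by (rule ring.is_abelian_group)
  next
    fix a C assume "a \<in> carrier K" "C \<in> carrier ?Q"
    then show "a \<odot>\<^bsub>?Q\<^esub> C \<in> carrier ?Q"
      by (auto dest!: rep simp: sm intro!: mem)
  next
    fix a b C assume "a \<in> carrier K" "b \<in> carrier K" "C \<in> carrier ?Q"
    then show "(a \<oplus>\<^bsub>K\<^esub> b) \<odot>\<^bsub>?Q\<^esub> C = a \<odot>\<^bsub>?Q\<^esub> C \<oplus>\<^bsub>?Q\<^esub> b \<odot>\<^bsub>?Q\<^esub> C"
      by (auto dest!: rep simp: sm add smult_l_distr)
  next
    fix a C D assume "a \<in> carrier K" "C \<in> carrier ?Q" "D \<in> carrier ?Q"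
    then show "a \<odot>\<^bsub>?Q\<^esub> (C \<oplus>\<^bsub>?Q\<^esub> D) = a \<odot>\<^bsub>?Q\<^esub> C \<oplus>\<^bsub>?Q\<^esub> a \<odot>\<^bsub>?Q\<^esub> D"
      by (auto dest!: rep simp: sm add smult_r_distr)
  next
    fix a b C assume "a \<in> carrier K" "b \<in> carrier K" "C \<in> carrier ?Q"
    then show "(a \<otimes>\<^bsub>K\<^esub> b) \<odot>\<^bsub>?Q\<^esub> C = a \<odot>\<^bsub>?Q\<^esub> (b \<odot>\<^bsub>?Q\<^esub> C)"
      by (auto dest!: rep simp: sm smult_assoc1)
  next
    fix C assume "C \<in> carrier ?Q"
    then show "\<one>\<^bsub>K\<^esub> \<odot>\<^bsub>?Q\<^esub> C = C"
      by (auto dest!: rep simp: sm)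
  qed
  moreover have "assoc_algebra_axioms K ?Q"
  proof (rule assoc_algebra_axioms.intro)
    fix a C D assume "a \<in> carrier K" "C \<in> carrier ?Q" "D \<in> carrier ?Q"
    then show "(a \<odot>\<^bsub>?Q\<^esub> C) \<otimes>\<^bsub>?Q\<^esub> D = a \<odot>\<^bsub>?Q\<^esub> (C \<otimes>\<^bsub>?Q\<^esub> D)"
      and "C \<otimes>\<^bsub>?Q\<^esub> (a \<odot>\<^bsub>?Q\<^esub> D) = a \<odot>\<^bsub>?Q\<^esub> (C \<otimes>\<^bsub>?Q\<^esub> D)"
      by (auto dest!: rep simp: sm mul smult_mult_left smult_mult_right)
  qed
  ultimately show ?thesis
    using ringQ by (intro assoc_algebra.intro)
qed

end

theory Submission
  imports Defs
begin

text \<open>In an affine algebra \<open>R\<close>, an ideal \<open>I\<close> with \<open>R / I\<close> finitely generated contains a finite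
  set \<open>F\<close> such that already \<open>R / F R\<close> is a finitely generated module. If \<open>J\<close> is a second such
  ideal, say \<open>R = K D + J\<close> with \<open>D\<close> finite, then \<open>F R \<subseteq> K F D + I J\<close>, so \<open>R / I J\<close> is finitely
  generated. The same finite sets show that a chain of ideals with infinitely generated quotients
  has a union of that kind, and an ideal maximal among these is prime because the family of the
  others is closed under products. For primeness of a just infinite algebra, an element \<open>x \<noteq> 0\<close> that
  annihilates on both sides a nonzero ideal \<open>L\<close> with \<open>R = K C + L\<close> generates the ideal
  \<open>R x R = K C x C\<close>, which would make \<open>R\<close> finitely generated.\<close>

section \<open>Linear maps, submodules and generating sets over a commutative ring\<close>

context module
begin

text \<open>Zero is its own multiple by the scalar 0, so compatibility with scalars carries it to
  zero.\<close>

lemma linear_zero: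
  assumes N: "module R N" and f: "f \<in> carrier M \<rightarrow> carrier N"
    and smult: "\<And>a x. \<lbrakk>a \<in> carrier R; x \<in> carrier M\<rbrakk> \<Longrightarrow> f (a \<odot>\<^bsub>M\<^esub> x) = a \<odot>\<^bsub>N\<^esub> f x"
  shows "f \<zero>\<^bsub>M\<^esub> = \<zero>\<^bsub>N\<^esub>"
proof -
  interpret N: module R N by (rule N)
  have "f \<zero>\<^bsub>M\<^esub> = f (\<zero>\<^bsub>R\<^esub> \<odot>\<^bsub>M\<^esub> \<zero>\<^bsub>M\<^esub>)" by simp
  also have "\<dots> = \<zero>\<^bsub>N\<^esub>" using f by (subst smult) (auto intro!: N.smult_l_null)
  finally show ?thesis .
qed

text \<open>Negation is multiplication by the scalar -1.\<close>

lemma linear_minus: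
  assumes N: "module R N" and f: "f \<in> carrier M \<rightarrow> carrier N"
    and smult: "\<And>a x. \<lbrakk>a \<in> carrier R; x \<in> carrier M\<rbrakk> \<Longrightarrow> f (a \<odot>\<^bsub>M\<^esub> x) = a \<odot>\<^bsub>N\<^esub> f x"
    and x: "x \<in> carrier M"
  shows "f (\<ominus>\<^bsub>M\<^esub> x) = \<ominus>\<^bsub>N\<^esub> f x"
proof -
  interpret N: module R N by (rule N)
  have fx: "f x \<in> carrier N" using f x by blast
  have "\<ominus>\<^bsub>M\<^esub> x = (\<ominus>\<^bsub>R\<^esub> \<one>\<^bsub>R\<^esub>) \<odot>\<^bsub>M\<^esub> x" using x by (simp add: smult_l_minus)
  then have "f (\<ominus>\<^bsub>M\<^esub> x) = (\<ominus>\<^bsub>R\<^esub> \<one>\<^bsub>R\<^esub>) \<odot>\<^bsub>N\<^esub> f x" using x by (simp add: smult)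
  also have "\<dots> = \<ominus>\<^bsub>N\<^esub> f x" using fx by (simp add: N.smult_l_minus)
  finally show ?thesis .
qed

lemma submodule_zero_closed:
  assumes "submodule H R M"
  shows "\<zero>\<^bsub>M\<^esub> \<in> H"
  using assms by (simp add: submodule_def subgroup_def)

text \<open>Supports the generator arguments below: a condition of the form
  \<open>f x \<in> H\<close> holds everywhere once it holds on module generators.\<close>

lemma submodule_vimage:
  assumes N: "module R N" and H: "submodule H R N" and f: "f \<in> carrier M \<rightarrow> carrier N"
    and add: "\<And>x y. \<lbrakk>x \<in> carrier M; y \<in> carrier M\<rbrakk> \<Longrightarrow> f (x \<oplus>\<^bsub>M\<^esub> y) = f x \<oplus>\<^bsub>N\<^esub> f y"
    and smult: "\<And>a x. \<lbrakk>a \<in> carrier R; x \<in> carrier M\<rbrakk> \<Longrightarrow> f (a \<odot>\<^bsub>M\<^esub> x) = a \<odot>\<^bsub>N\<^esub> f x"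
  shows "submodule {x \<in> carrier M. f x \<in> H} R M"
proof -
  interpret N: module R N by (rule N)
  show ?thesis
    using N.submoduleE[OF H] N.submodule_zero_closed[OF H] linear_zero[OF N f smult]
    by (intro submoduleI) (auto simp: add smult linear_minus[OF N f smult])
qed

lemma submodule_image:
  assumes N: "module R N" and H: "submodule H R M" and f: "f \<in> carrier M \<rightarrow> carrier N"
    and add: "\<And>x y. \<lbrakk>x \<in> carrier M; y \<in> carrier M\<rbrakk> \<Longrightarrow> f (x \<oplus>\<^bsub>M\<^esub> y) = f x \<oplus>\<^bsub>N\<^esub> f y"
    and smult: "\<And>a x. \<lbrakk>a \<in> carrier R; x \<in> carrier M\<rbrakk> \<Longrightarrow> f (a \<odot>\<^bsub>M\<^esub> x) = a \<odot>\<^bsub>N\<^esub> f x"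
  shows "submodule (f ` H) R N"
proof -
  interpret N: module R N by (rule N)
  note HE = submoduleE[OF H]
  show ?thesis
  proof (rule N.submoduleI)
    show "f ` H \<subseteq> carrier N" using f HE(1) by auto
    show "\<zero>\<^bsub>N\<^esub> \<in> f ` H" using submodule_zero_closed[OF H] linear_zero[OF N f smult] by force
    show "\<ominus>\<^bsub>N\<^esub> y \<in> f ` H" if "y \<in> f ` H" for y
    proof -
      from that obtain h where h: "h \<in> H" "y = f h" by blast
      then have "\<ominus>\<^bsub>N\<^esub> y = f (\<ominus>\<^bsub>M\<^esub> h)"
        using HE(1) linear_minus[OF N f smult] by (auto simp: subset_iff)
      then show ?thesis using HE(3)[OF h(1)] by blast
    qed
    show "y \<oplus>\<^bsub>N\<^esub> z \<in> f ` H" if "y \<in> f ` H" "z \<in> f ` H" for y z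
    proof -
      from that obtain h k where h: "h \<in> H" "k \<in> H" "y = f h" "z = f k" by blast
      then have "y \<oplus>\<^bsub>N\<^esub> z = f (h \<oplus>\<^bsub>M\<^esub> k)" using HE(1) add by (auto simp: subset_iff)
      then show ?thesis using HE(5)[OF h(1,2)] by blast
    qed
    show "a \<odot>\<^bsub>N\<^esub> y \<in> f ` H" if a: "a \<in> carrier R" and y: "y \<in> f ` H" for a y
    proof -
      from y obtain h where h: "h \<in> H" "y = f h" by blast
      then have "a \<odot>\<^bsub>N\<^esub> y = f (a \<odot>\<^bsub>M\<^esub> h)" using HE(1) a smult by (auto simp: subset_iff)
      then show ?thesis using HE(4)[OF a h(1)] by blast
    qed
  qed
qed

lemma submodule_set_add:
  assumes S: "submodule S R M" and L: "submodule L R M"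
  shows "submodule (S <+>\<^bsub>M\<^esub> L) R M"
proof -
  note SE = submoduleE[OF S] and LE = submoduleE[OF L]
  let ?T = "S <+>\<^bsub>M\<^esub> L"
  have T: "?T = {s \<oplus>\<^bsub>M\<^esub> x | s x. s \<in> S \<and> x \<in> L}" by (auto simp: set_add_def')
  show ?thesis
  proof (rule submoduleI)
    show "?T \<subseteq> carrier M" using SE(1) LE(1) by (auto simp: T)
    show "\<zero>\<^bsub>M\<^esub> \<in> ?T"
      using submodule_zero_closed[OF S] submodule_zero_closed[OF L]
      unfolding T by (intro CollectI exI[of _ "\<zero>\<^bsub>M\<^esub>"]) auto
    show "\<ominus>\<^bsub>M\<^esub> a \<in> ?T" if "a \<in> ?T" for a
    proof -
      from that obtain s x where "a = s \<oplus>\<^bsub>M\<^esub> x" "s \<in> S" "x \<in> L" by (auto simp: T)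
      then have "\<ominus>\<^bsub>M\<^esub> a = \<ominus>\<^bsub>M\<^esub> s \<oplus>\<^bsub>M\<^esub> \<ominus>\<^bsub>M\<^esub> x" "\<ominus>\<^bsub>M\<^esub> s \<in> S" "\<ominus>\<^bsub>M\<^esub> x \<in> L"
        using SE(1,3) LE(1,3) by (auto simp: subset_iff M.minus_add)
      then show ?thesis by (auto simp: T)
    qed
    show "a \<oplus>\<^bsub>M\<^esub> b \<in> ?T" if "a \<in> ?T" "b \<in> ?T" for a b
    proof -
      from that obtain s x t y where *: "a = s \<oplus>\<^bsub>M\<^esub> x" "s \<in> S" "x \<in> L"
          "b = t \<oplus>\<^bsub>M\<^esub> y" "t \<in> S" "y \<in> L"
        by (auto simp: T)
      have c: "s \<in> carrier M" "x \<in> carrier M" "t \<in> carrier M" "y \<in> carrier M"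
        using * SE(1) LE(1) by auto
      have "a \<oplus>\<^bsub>M\<^esub> b = (s \<oplus>\<^bsub>M\<^esub> t) \<oplus>\<^bsub>M\<^esub> (x \<oplus>\<^bsub>M\<^esub> y)" using * c by (simp add: M.a_ac)
      moreover have "s \<oplus>\<^bsub>M\<^esub> t \<in> S" "x \<oplus>\<^bsub>M\<^esub> y \<in> L" using * SE(5) LE(5) by blast+
      ultimately show ?thesis unfolding T by blast
    qed
    show "a \<odot>\<^bsub>M\<^esub> b \<in> ?T" if "a \<in> carrier R" "b \<in> ?T" for a b
    proof -
      from that(2) obtain s x where "b = s \<oplus>\<^bsub>M\<^esub> x" "s \<in> S" "x \<in> L" by (auto simp: T)
      then have "a \<odot>\<^bsub>M\<^esub> b = a \<odot>\<^bsub>M\<^esub> s \<oplus>\<^bsub>M\<^esub> a \<odot>\<^bsub>M\<^esub> x" "a \<odot>\<^bsub>M\<^esub> s \<in> S" "a \<odot>\<^bsub>M\<^esub> x \<in> L"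
        using that(1) SE(1,4) LE(1,4) by (auto simp: subset_iff smult_r_distr)
      then show ?thesis by (auto simp: T)
    qed
  qed
qed

lemma submodule_generated_is_submodule:
  assumes "B \<subseteq> carrier M"
  shows "submodule (submodule_generated R M B) R M"
proof (rule submoduleI)
  show "submodule_generated R M B \<subseteq> carrier M"
    using assms carrier_is_submodule by (auto simp: submodule_generated_def)
qed (auto simp: submodule_generated_def submodule_zero_closed submoduleE)

lemma subset_submodule_generated: "B \<subseteq> submodule_generated R M B"
  by (auto simp: submodule_generated_def)

lemma submodule_generated_minimal:
  "\<lbrakk>submodule H R M; B \<subseteq> H\<rbrakk> \<Longrightarrow> submodule_generated R M B \<subseteq> H"
  by (auto simp: submodule_generated_def)

text \<open>This form avoids linear combinations: finite generation is proved and used by testing an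
  arbitrary submodule that contains the generators.\<close>

lemma fg_module_iff:
  "fg_module R M \<longleftrightarrow>
    (\<exists>B \<subseteq> carrier M. finite B \<and> (\<forall>H. submodule H R M \<and> B \<subseteq> H \<longrightarrow> H = carrier M))"
proof -
  have "submodule_generated R M B = carrier M \<longleftrightarrow>
      (\<forall>H. submodule H R M \<and> B \<subseteq> H \<longrightarrow> H = carrier M)" if B: "B \<subseteq> carrier M" for B
    using submodule_generated_is_submodule[OF B] subset_submodule_generated[of B]
      submodule_generated_minimal[of _ B] submoduleE(1)
    by (metis subset_antisym)
  then show ?thesis unfolding fg_module_def by blast
qed

end

section \<open>Finitely generated quotients, described by submodules of the algebra itself\<close>

context assoc_algebra
begin

text \<open>Multiplication by a fixed element is \<open>K\<close>-linear, so whether products lie in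
  \<open>H\<close> can be checked on module generators of the other factor.\<close>

lemma submodule_mult_left_vimage:
  assumes "submodule H K R" "a \<in> carrier R"
  shows "submodule {x \<in> carrier R. a \<otimes> x \<in> H} K R"
  using assms by (intro submodule_vimage[OF module_axioms]) (auto simp: r_distr smult_mult_right)

lemma submodule_mult_right_vimage:
  assumes "submodule H K R" "a \<in> carrier R"
  shows "submodule {x \<in> carrier R. x \<otimes> a \<in> H} K R"
  using assms by (intro submodule_vimage[OF module_axioms]) (auto simp: l_distr smult_mult_left)

lemma ideal_is_submodule:
  assumes "ideal I R"
  shows "submodule I K R"
  using assms ideal_smult_closed[OF assms]
  by (simp add: submodule_def submodule_axioms_def ideal_def additive_subgroup_def)

text \<open>Submodules of the quotient correspond to submodules of \<open>R\<close> containing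
  \<open>I\<close>, by image and preimage along \<open>?p\<close>. Later proofs can then work in
  \<open>R\<close> and never handle cosets.\<close>

lemma fg_quotient_iff:
  assumes I: "ideal I R"
  shows "fg_module K (quotient_algebra R I) \<longleftrightarrow>
    (\<exists>C \<subseteq> carrier R. finite C \<and> (\<forall>H. submodule H K R \<and> C \<subseteq> H \<and> I \<subseteq> H \<longrightarrow> H = carrier R))"
    (is "?L \<longleftrightarrow> ?R")
proof -
  let ?Q = "quotient_algebra R I"
  let ?p = "\<lambda>x. I +> x"
  interpret I: ideal I R by (rule I)
  interpret Q: assoc_algebra K ?Q by (rule quotient_assoc_algebra[OF I])
  have carr: "carrier ?Q = ?p ` carrier R"
    by (auto simp: quotient_algebra_def ring.defs module.defs FactRing_def A_RCOSETS_def')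
  have zero: "\<zero>\<^bsub>?Q\<^esub> = I"
    by (simp add: quotient_algebra_def ring.defs module.defs FactRing_def)
  have p: "?p \<in> carrier R \<rightarrow> carrier ?Q" by (auto simp: carr)
  have add: "?p (x \<oplus> y) = ?p x \<oplus>\<^bsub>?Q\<^esub> ?p y" if "x \<in> carrier R" "y \<in> carrier R" for x y
    using that I.a_rcos_sum by (simp add: quotient_algebra_def ring.defs module.defs FactRing_def)
  note smult = quotient_smult[OF I, symmetric]
  have p_I: "?p x = \<zero>\<^bsub>?Q\<^esub>" if "x \<in> I" for x
    using that by (simp add: I.a_rcos_const zero)
  show ?thesis
  proof
    assume ?L
    then obtain B where B: "B \<subseteq> carrier ?Q" "finite B"
      and gen: "\<And>H. \<lbrakk>submodule H K ?Q; B \<subseteq> H\<rbrakk> \<Longrightarrow> H = carrier ?Q"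
      unfolding Q.fg_module_iff by blast
    from B obtain C where C: "C \<subseteq> carrier R" "finite C" "B = ?p ` C"
      unfolding carr by (meson finite_subset_image)
    have "H = carrier R" if H: "submodule H K R" "C \<subseteq> H" "I \<subseteq> H" for H
    proof
      show "H \<subseteq> carrier R" using submoduleE(1)[OF H(1)] .
      \<comment> \<open>The image of \<open>H\<close> contains \<open>B\<close>, hence is
        everything; an arbitrary \<open>r\<close> then differs from some \<open>h \<in> H\<close> by
        an element of \<open>I \<subseteq> H\<close>.\<close>
      have im: "?p ` H = carrier ?Q"
        using H C by (intro gen submodule_image[OF Q.module_axioms H(1) p add smult]) auto
      show "carrier R \<subseteq> H"
      proof
        fix r assume r: "r \<in> carrier R"
        with im obtain h where h: "h \<in> H" "?p r = ?p h" unfolding carr by blast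
        then have "r \<in> I +> h" using I.a_rcos_self[OF r] by simp
        then show "r \<in> H" using h H submoduleE(5)[OF H(1)] by (auto simp: a_r_coset_def')
      qed
    qed
    with C show ?R by blast
  next
    assume ?R
    then obtain C where C: "C \<subseteq> carrier R" "finite C"
      and gen: "\<forall>H. submodule H K R \<and> C \<subseteq> H \<and> I \<subseteq> H \<longrightarrow> H = carrier R"
      by (elim exE conjE)
    have "H = carrier ?Q" if H: "submodule H K ?Q" "?p ` C \<subseteq> H" for H
    proof
      show "H \<subseteq> carrier ?Q" using Q.submoduleE(1)[OF H(1)] .
      have "\<zero>\<^bsub>?Q\<^esub> \<in> H" using Q.submodule_zero_closed[OF H(1)] .
      \<comment> \<open>\<open>?p\<close> sends \<open>I\<close> to zero, so the preimage of
        \<open>H\<close> contains \<open>I\<close> as well as \<open>C\<close>.\<close>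
      then have "{x \<in> carrier R. ?p x \<in> H} = carrier R"
        using C H(2) p_I I.a_subset
        by (intro gen[rule_format] conjI submodule_vimage[OF Q.module_axioms H(1) p add smult]) auto
      then show "carrier ?Q \<subseteq> H" by (auto simp: carr)
    qed
    with C p show ?L unfolding Q.fg_module_iff by (intro exI[of _ "?p ` C"]) auto
  qed
qed

lemma fg_quotientI:
  assumes "ideal I R" "finite C" "C \<subseteq> carrier R"
    and "\<And>H. \<lbrakk>submodule H K R; C \<subseteq> H; I \<subseteq> H\<rbrakk> \<Longrightarrow> H = carrier R"
  shows "fg_module K (quotient_algebra R I)"
  unfolding fg_quotient_iff[OF assms(1)]
  by (intro exI[of _ C] conjI allI impI assms(2,3)) (elim conjE, rule assms(4))

lemma fg_quotientE:
  assumes "ideal I R" "fg_module K (quotient_algebra R I)"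
  obtains C where "finite C" "C \<subseteq> carrier R"
    and "\<And>H. \<lbrakk>submodule H K R; C \<subseteq> H; I \<subseteq> H\<rbrakk> \<Longrightarrow> H = carrier R"
proof -
  from assms(2) obtain C where "C \<subseteq> carrier R" "finite C"
    and gen: "\<forall>H. submodule H K R \<and> C \<subseteq> H \<and> I \<subseteq> H \<longrightarrow> H = carrier R"
    unfolding fg_quotient_iff[OF assms(1)] by (elim exE conjE)
  then show ?thesis by (intro that[of C]) (simp_all add: gen[rule_format])
qed

section \<open>Affine algebras: products of ideals with finitely generated quotients\<close>

text \<open>The set \<open>F\<close> consists of the \<open>I\<close>-components of the products of a module generator of
  \<open>R / I\<close> with an algebra generator of \<open>R\<close>: the submodule spanned by the module generators and
  \<open>F R\<close> is then stable under right multiplication and contains \<open>1\<close>.\<close>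

lemma affine_cofinite_spanned:
  assumes aff: "affine_algebra K R" and I: "ideal I R" and fg: "fg_module K (quotient_algebra R I)"
  obtains C F where "finite C" "C \<subseteq> carrier R" "finite F" "F \<subseteq> I"
    and "\<And>H. \<lbrakk>submodule H K R; C \<subseteq> H; \<forall>x\<in>F. \<forall>r\<in>carrier R. x \<otimes> r \<in> H\<rbrakk> \<Longrightarrow> H = carrier R"
proof -
  interpret I: ideal I R by (rule I)
  obtain B where B: "B \<subseteq> carrier R" "finite B" "subalgebra_generated K R B = carrier R"
    using aff unfolding affine_algebra_def by blast
  obtain C0 where C0: "finite C0" "C0 \<subseteq> carrier R"
    and gen0: "\<And>H. \<lbrakk>submodule H K R; C0 \<subseteq> H; I \<subseteq> H\<rbrakk> \<Longrightarrow> H = carrier R"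
    by (rule fg_quotientE[OF I fg]) (rule that)
  \<comment> \<open>The unit is added so that the span \<open>?V\<close> below contains
    \<open>\<one>\<close>; with stability under right multiplication this makes \<open>?V\<close>
    all of \<open>R\<close>.\<close>
  define C where "C = insert \<one> C0"
  have C: "C \<subseteq> carrier R" "finite C" using C0 by (auto simp: C_def)
  have gen: "H = carrier R" if "submodule H K R" "C \<subseteq> H" "I \<subseteq> H" for H
    using that gen0 by (auto simp: C_def)
  let ?S = "submodule_generated K R C"
  have S: "submodule ?S K R" by (rule submodule_generated_is_submodule[OF C(1)])
  \<comment> \<open>The sum of \<open>?S\<close> and \<open>I\<close> is a submodule containing
    \<open>C\<close> and \<open>I\<close>, hence all of \<open>R\<close>.\<close>
  have "\<exists>x\<in>I. \<exists>s\<in>?S. r = s \<oplus> x" if r: "r \<in> carrier R" for r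
  proof -
    let ?T = "?S <+>\<^bsub>R\<^esub> I"
    have T: "?T = {s \<oplus> x | s x. s \<in> ?S \<and> x \<in> I}" by (auto simp: set_add_def')
    have Sz: "\<zero> \<in> ?S" by (rule submodule_zero_closed[OF S])
    have sub: "submodule ?T K R"
      by (rule submodule_set_add[OF S ideal_is_submodule[OF I]])
    have "C \<subseteq> ?T"
    proof
      fix c assume c: "c \<in> C"
      then have "c = c \<oplus> \<zero>" using C by auto
      then show "c \<in> ?T" using c subset_submodule_generated[of C] I.zero_closed unfolding T by blast
    qed
    moreover have "I \<subseteq> ?T"
    proof
      fix c assume c: "c \<in> I"
      then have "c = \<zero> \<oplus> c" by (simp add: I.Icarr)
      then show "c \<in> ?T" using c Sz unfolding T by blast
    qed
    ultimately show ?thesis using gen[OF sub] r T by blast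
  qed
  \<comment> \<open>\<open>f r\<close> is a chosen \<open>I\<close>-component of \<open>r\<close>
    modulo the span of \<open>C\<close>.\<close>
  then obtain f where f: "\<And>r. r \<in> carrier R \<Longrightarrow> f r \<in> I \<and> (\<exists>s\<in>?S. r = s \<oplus> f r)"
    by metis
  define F where "F = (\<lambda>(c, b). f (c \<otimes> b)) ` (C \<times> B)"
  have F: "finite F" "F \<subseteq> I" using C B f by (auto simp: F_def subset_iff)
  then have Fc: "F \<subseteq> carrier R" using I.a_subset by blast
  show thesis
  proof (rule that[OF C(2,1) F])
    show "H = carrier R"
      if H: "submodule H K R" "C \<subseteq> H" "\<forall>x\<in>F. \<forall>r\<in>carrier R. x \<otimes> r \<in> H" for H
    proof -
      define G where "G = C \<union> {x \<otimes> r | x r. x \<in> F \<and> r \<in> carrier R}"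
      have G: "G \<subseteq> carrier R" using C Fc by (auto simp: G_def)
      let ?V = "submodule_generated K R G"
      have V: "submodule ?V K R" by (rule submodule_generated_is_submodule[OF G])
      note VE = submoduleE[OF V] and GV = subset_submodule_generated[of G]
      have SV: "?S \<subseteq> ?V"
        using GV by (intro submodule_generated_minimal[OF V]) (auto simp: G_def)
      have FV: "x \<otimes> r \<in> ?V" if "x \<in> F" "r \<in> carrier R" for x r
        using that GV by (auto simp: G_def)
      \<comment> \<open>\<open>?U\<close> consists of the elements whose right multiplication maps
        \<open>?V\<close> into itself. It is a subalgebra, so it is \<open>R\<close> as soon as it
        contains the algebra generators \<open>B\<close>.\<close>
      let ?U = "{r \<in> carrier R. \<forall>v\<in>?V. v \<otimes> r \<in> ?V}"
      have "B \<subseteq> ?U"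
      proof
        fix b assume b: "b \<in> B"
        then have bc: "b \<in> carrier R" using B by blast
        have "G \<subseteq> {v \<in> carrier R. v \<otimes> b \<in> ?V}"
        proof
          fix g assume g: "g \<in> G"
          then consider "g \<in> C" | x r where "g = x \<otimes> r" "x \<in> F" "r \<in> carrier R"
            by (auto simp: G_def)
          then have "g \<otimes> b \<in> ?V"
          proof cases
            case 1
            \<comment> \<open>\<open>g \<otimes> b\<close> is an element of \<open>?S\<close> plus
              \<open>f (g \<otimes> b)\<close>, and this component lies in \<open>F\<close>, hence
              in \<open>?V\<close> as its product with \<open>\<one>\<close>.\<close>
            then have gb: "g \<otimes> b \<in> carrier R" using C bc by blast
            have "f (g \<otimes> b) \<in> F" using 1 b by (force simp: F_def)
            then have "f (g \<otimes> b) \<in> ?V" using FV[of "f (g \<otimes> b)" \<one>] Fc by auto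
            with f[OF gb] SV VE(5) show ?thesis by (metis subsetD)
          next
            case 2
            then show ?thesis using FV bc Fc by (auto simp: m_assoc subset_iff)
          qed
          with g G show "g \<in> {v \<in> carrier R. v \<otimes> b \<in> ?V}" by blast
        qed
        then have "?V \<subseteq> {v \<in> carrier R. v \<otimes> b \<in> ?V}"
          by (intro submodule_generated_minimal submodule_mult_right_vimage[OF V bc])
        with bc show "b \<in> ?U" by blast
      qed
      moreover have V0: "\<zero> \<in> ?V" by (rule submodule_zero_closed[OF V])
      have "submodule ?U K R"
        using VE V0 by (intro submoduleI) (auto simp: subset_iff r_distr r_minus smult_mult_right)
      moreover have "subring ?U R"
        using VE V0 by (intro subringI) (auto simp: subset_iff r_distr r_minus m_assoc[symmetric])
      ultimately have "carrier R \<subseteq> ?U"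
        unfolding B(3)[symmetric] subalgebra_generated_def by blast
      moreover have "\<one> \<in> ?V" using SV subset_submodule_generated[of C] by (auto simp: C_def)
      ultimately have "carrier R \<subseteq> ?V" by force
      moreover have "?V \<subseteq> H"
        using H by (intro submodule_generated_minimal) (auto simp: G_def)
      ultimately show ?thesis using submoduleE(1)[OF H(1)] by blast
    qed
  qed
qed

lemma fg_quotient_mono:
  assumes "ideal I R" "ideal J R" "I \<subseteq> J" "fg_module K (quotient_algebra R I)"
  shows "fg_module K (quotient_algebra R J)"
proof -
  obtain C where C: "finite C" "C \<subseteq> carrier R"
    and gen: "\<And>H. \<lbrakk>submodule H K R; C \<subseteq> H; I \<subseteq> H\<rbrakk> \<Longrightarrow> H = carrier R"
    by (rule fg_quotientE[OF assms(1,4)]) (rule that)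
  show ?thesis
    using assms(3) by (intro fg_quotientI[OF assms(2) C] gen) auto
qed

text \<open>Only the finite set \<open>F\<close> has to be treated: for \<open>x \<in> F\<close> the
  finitely many products \<open>x \<otimes> d\<close> with \<open>d \<in> D\<close> span
  \<open>x R\<close> modulo \<open>I J\<close>.\<close>

lemma fg_quotient_prod:
  assumes aff: "affine_algebra K R" and I: "ideal I R" and J: "ideal J R"
    and fgI: "fg_module K (quotient_algebra R I)" and fgJ: "fg_module K (quotient_algebra R J)"
  shows "fg_module K (quotient_algebra R (I \<cdot>\<^bsub>R\<^esub> J))"
proof -
  obtain C F where C: "finite C" "C \<subseteq> carrier R" and F: "finite F" "F \<subseteq> I"
    and genI: "\<And>H. \<lbrakk>submodule H K R; C \<subseteq> H; \<forall>x\<in>F. \<forall>r\<in>carrier R. x \<otimes> r \<in> H\<rbrakk> \<Longrightarrow> H = carrier R"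
    by (rule affine_cofinite_spanned[OF aff I fgI]) (rule that)
  obtain D where D: "finite D" "D \<subseteq> carrier R"
    and genJ: "\<And>H. \<lbrakk>submodule H K R; D \<subseteq> H; J \<subseteq> H\<rbrakk> \<Longrightarrow> H = carrier R"
    by (rule fg_quotientE[OF J fgJ]) (rule that)
  define E where "E = C \<union> (\<lambda>(x, d). x \<otimes> d) ` (F \<times> D)"
  have Fc: "F \<subseteq> carrier R" using F ideal.Icarr[OF I] by blast
  have "E \<subseteq> carrier R" "finite E" using C D F Fc by (auto simp: E_def)
  moreover have "H = carrier R" if H: "submodule H K R" "E \<subseteq> H" "I \<cdot>\<^bsub>R\<^esub> J \<subseteq> H" for H
  proof (rule genI[OF H(1)])
    show "C \<subseteq> H" using H(2) by (auto simp: E_def)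
    show "\<forall>x\<in>F. \<forall>r\<in>carrier R. x \<otimes> r \<in> H"
    proof
      fix x assume x: "x \<in> F"
      \<comment> \<open>This set contains \<open>D\<close> by the choice of \<open>E\<close>, and it
        contains \<open>J\<close> because \<open>x \<in> I\<close> gives
        \<open>x J \<subseteq> I J \<subseteq> H\<close>.\<close>
      have "{r \<in> carrier R. x \<otimes> r \<in> H} = carrier R"
      proof (rule genJ)
        show "submodule {r \<in> carrier R. x \<otimes> r \<in> H} K R"
          using x Fc by (intro submodule_mult_left_vimage H) auto
        show "D \<subseteq> {r \<in> carrier R. x \<otimes> r \<in> H}" using x H(2) D by (force simp: E_def)
        show "J \<subseteq> {r \<in> carrier R. x \<otimes> r \<in> H}"
          using x F H(3) ideal.Icarr[OF J] by (auto intro: ideal_prod.prod)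
      qed
      then show "\<forall>r\<in>carrier R. x \<otimes> r \<in> H" by blast
    qed
  qed
  ultimately show ?thesis by (intro fg_quotientI[OF ideal_prod_is_ideal[OF I J], of E])
qed

lemma fg_quotient_carrier: "fg_module K (quotient_algebra R (carrier R))"
  using submoduleE(1) by (intro fg_quotientI[OF oneideal, of "{}"]) auto

lemma cofinite_ideals_satisfies_P1:
  assumes "affine_algebra K R"
  shows "satisfies_P1 R (cofinite_ideals K R)"
  unfolding satisfies_P1_def cofinite_ideals_def
  using fg_quotient_carrier oneideal fg_quotient_prod[OF assms] ideal_prod_is_ideal fg_quotient_mono
  by auto

section \<open>Primeness of just infinite algebras\<close>

text \<open>As \<open>x\<close> kills \<open>L\<close> on both sides, the factors of
  \<open>r x s\<close> matter only modulo \<open>L\<close>, so finitely many \<open>c x d\<close>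
  span the ideal of \<open>x\<close>. Generators of \<open>R\<close> modulo that ideal complete them
  to generators of \<open>R\<close>.\<close>

lemma fg_module_of_cofinite_annihilator:
  assumes x: "x \<in> carrier R" and L: "ideal L R"
    and ann: "\<And>y. y \<in> L \<Longrightarrow> x \<otimes> y = \<zero> \<and> y \<otimes> x = \<zero>"
    and fgL: "fg_module K (quotient_algebra R L)"
    and fgx: "fg_module K (quotient_algebra R (Idl {x}))"
  shows "fg_module K R"
proof -
  have T: "ideal (Idl {x}) R" using x by (intro genideal_ideal) auto
  obtain C where C: "finite C" "C \<subseteq> carrier R"
    and genL: "\<And>H. \<lbrakk>submodule H K R; C \<subseteq> H; L \<subseteq> H\<rbrakk> \<Longrightarrow> H = carrier R"
    by (rule fg_quotientE[OF L fgL]) (rule that)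
  obtain D where D: "finite D" "D \<subseteq> carrier R"
    and genT: "\<And>H. \<lbrakk>submodule H K R; D \<subseteq> H; Idl {x} \<subseteq> H\<rbrakk> \<Longrightarrow> H = carrier R"
    by (rule fg_quotientE[OF T fgx]) (rule that)
  define E where "E = D \<union> (\<lambda>(c, d). c \<otimes> x \<otimes> d) ` (C \<times> C)"
  have E: "E \<subseteq> carrier R" "finite E" using C D x by (auto simp: E_def subset_iff)
  have "H = carrier R" if H: "submodule H K R" "E \<subseteq> H" for H
  proof (rule genT[OF H(1)])
    have H0: "\<zero> \<in> H" by (rule submodule_zero_closed[OF H(1)])
    note HE = submoduleE[OF H(1)]
    show "D \<subseteq> H" using H(2) by (auto simp: E_def)
    have CC: "c \<otimes> x \<otimes> d \<in> H" if "c \<in> C" "d \<in> C" for c d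
      using that H(2) by (force simp: E_def)
    \<comment> \<open>The factors are extended from \<open>C\<close> to \<open>R\<close> one at a
      time, first on the right using \<open>x L = 0\<close>, then on the left using
      \<open>L x = 0\<close>.\<close>
    have CR: "c \<otimes> x \<otimes> s \<in> H" if c: "c \<in> C" and s: "s \<in> carrier R" for c s
    proof -
      have cc: "c \<in> carrier R" using c C by blast
      have "{s \<in> carrier R. c \<otimes> x \<otimes> s \<in> H} = carrier R"
        using c cc C x CC ideal.Icarr[OF L] ann H0
        by (intro genL submodule_mult_left_vimage H) (auto simp: m_assoc)
      with s show ?thesis by blast
    qed
    have RR: "r \<otimes> x \<otimes> s \<in> H" if r: "r \<in> carrier R" and s: "s \<in> carrier R" for r s
    proof -
      have "{r \<in> carrier R. r \<otimes> (x \<otimes> s) \<in> H} = carrier R"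
      proof (rule genL)
        show "submodule {r \<in> carrier R. r \<otimes> (x \<otimes> s) \<in> H} K R"
          using x s by (intro submodule_mult_right_vimage H) auto
        show "C \<subseteq> {r \<in> carrier R. r \<otimes> (x \<otimes> s) \<in> H}"
          using CR s C x by (auto simp: m_assoc subset_iff)
        show "L \<subseteq> {r \<in> carrier R. r \<otimes> (x \<otimes> s) \<in> H}"
          using ideal.Icarr[OF L] ann H0 x s by (auto simp: m_assoc[symmetric])
      qed
      with r s x show ?thesis by (auto simp: m_assoc)
    qed
    \<comment> \<open>\<open>?U\<close> is the largest ideal contained in \<open>H\<close>; it
      contains \<open>x\<close> by \<open>RR\<close>, hence also the ideal generated by
      \<open>x\<close>.\<close>
    let ?U = "{t \<in> carrier R. \<forall>r\<in>carrier R. \<forall>s\<in>carrier R. r \<otimes> t \<otimes> s \<in> H}"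
    have "ideal ?U R"
    proof (rule idealI[OF ring_axioms])
      have "submodule ?U K R"
        using HE H0
        by (intro submoduleI)
          (auto simp: l_distr r_distr l_minus r_minus smult_mult_left smult_mult_right)
      then show "subgroup ?U (add_monoid R)" by (simp add: submodule_def)
      show "y \<otimes> t \<in> ?U" "t \<otimes> y \<in> ?U" if "t \<in> ?U" "y \<in> carrier R" for t y
        using that by (auto simp: m_assoc) (metis m_assoc m_closed)+
    qed
    then have "Idl {x} \<subseteq> ?U" using x RR by (intro genideal_minimal) auto
    moreover have "t \<in> H" if "t \<in> ?U" for t
    proof -
      from that have "t \<in> carrier R" "\<one> \<otimes> t \<otimes> \<one> \<in> H" by blast+
      then show ?thesis by simp
    qed
    ultimately show "Idl {x} \<subseteq> H" by blast
  qed
  with E show ?thesis unfolding fg_module_iff by blast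
qed

text \<open>If \<open>I J = 0\<close> with \<open>I\<close>, \<open>J\<close> nonzero, then one of the pairs \<open>(I, J)\<close> and
  \<open>(J I, J I)\<close> consists of nonzero ideals annihilating each other on both sides.\<close>

lemma just_infinite_imp_prime_ring:
  assumes ji: "just_infinite K R"
  shows "prime_ring R"
proof -
  have nfg: "\<not> fg_module K R"
    and fg: "\<And>I. \<lbrakk>ideal I R; I \<noteq> {\<zero>}\<rbrakk> \<Longrightarrow> fg_module K (quotient_algebra R I)"
    using ji unfolding just_infinite_def by auto
  \<comment> \<open>A nonzero \<open>x \<in> N\<close> generates a nonzero ideal, so the quotients
    by \<open>L\<close> and by \<open>Idl {x}\<close> are both finitely generated and
    \<open>R\<close> would be too.\<close>
  have ann: "N = {\<zero>}"
    if N: "ideal N R" and L: "ideal L R" "L \<noteq> {\<zero>}"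
      and NL: "\<And>x y. \<lbrakk>x \<in> N; y \<in> L\<rbrakk> \<Longrightarrow> x \<otimes> y = \<zero> \<and> y \<otimes> x = \<zero>" for N L
  proof (rule ccontr)
    assume "N \<noteq> {\<zero>}"
    then obtain x where x: "x \<in> N" "x \<noteq> \<zero>"
      using additive_subgroup.zero_closed[OF ideal.axioms(1)[OF N]] by blast
    have xc: "x \<in> carrier R" using ideal.Icarr[OF N x(1)] .
    have "Idl {x} \<noteq> {\<zero>}" using genideal_self'[OF xc] x(2) by blast
    then have "fg_module K R"
      using xc x(1) NL L by (intro fg_module_of_cofinite_annihilator[OF xc L(1)] fg genideal_ideal) auto
    with nfg show False by contradiction
  qed
  have prod: "I \<subseteq> {\<zero>} \<or> J \<subseteq> {\<zero>}"
    if I: "ideal I R" and J: "ideal J R" and IJ: "I \<cdot>\<^bsub>R\<^esub> J \<subseteq> {\<zero>}" for I J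
  proof (rule ccontr)
    assume neg: "\<not> (I \<subseteq> {\<zero>} \<or> J \<subseteq> {\<zero>})"
    have xy: "x \<otimes> y = \<zero>" if "x \<in> I" "y \<in> J" for x y
      using ideal_prod.prod[of x I y J R] that IJ by blast
    let ?N = "J \<cdot>\<^bsub>R\<^esub> I"
    have N: "ideal ?N R" by (rule ideal_prod_is_ideal[OF J I])
    have "?N \<subseteq> I" "?N \<subseteq> J" using ideal_prod_inter[OF J I] by auto
    then have "?N = {\<zero>}"
      using xy ann[OF N N] by blast
    then have yx: "y \<otimes> x = \<zero>" if "x \<in> I" "y \<in> J" for x y
      using ideal_prod.prod[of y J x I R] that by blast
    have "J \<noteq> {\<zero>}" using neg by blast
    then show False using ann[OF I J] xy yx neg by blast
  qed
  \<comment> \<open>A prime ideal must be proper; the zero ring is spanned by the empty set, which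
    \<open>nfg\<close> excludes.\<close>
  have "{\<zero>} \<noteq> carrier R"
  proof
    assume z: "{\<zero>} = carrier R"
    have "fg_module K R"
      unfolding fg_module_iff
    proof (intro exI[of _ "{}"] conjI allI impI)
      fix H assume "submodule H K R \<and> {} \<subseteq> H"
      then show "H = carrier R" using submoduleE(1)[of H] submodule_zero_closed[of H] unfolding z[symmetric] by blast
    qed auto
    with nfg show False by contradiction
  qed
  with prod show ?thesis
    unfolding prime_ring_def nc_prime_ideal_def using zeroideal ring_axioms by blast
qed

section \<open>Zorn's lemma and the reduction to prime ideals\<close>

lemma ideal_Union_chain:
  assumes "subset.chain {I. ideal I R} Ch" and ne: "Ch \<noteq> {}"
  shows "ideal (\<Union>Ch) R"
proof -
  have Ch: "\<And>I. I \<in> Ch \<Longrightarrow> ideal I R" and tot: "\<And>I J. \<lbrakk>I \<in> Ch; J \<in> Ch\<rbrakk> \<Longrightarrow> I \<subseteq> J \<or> J \<subseteq> I"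
    using assms(1) by (auto simp: subset.chain_def subset_chain_def)
  have "submodule (\<Union>Ch) K R"
  proof (rule submoduleI)
    note E = submoduleE[OF ideal_is_submodule[OF Ch]]
    show "\<Union>Ch \<subseteq> carrier R" using E(1) by blast
    show "\<zero> \<in> \<Union>Ch"
      using ne Ch by (meson UnionI additive_subgroup.zero_closed all_not_in_conv ideal.axioms(1))
    show "\<ominus> a \<in> \<Union>Ch" if "a \<in> \<Union>Ch" for a using that E(3) by blast
    show "a \<oplus> b \<in> \<Union>Ch" if ab: "a \<in> \<Union>Ch" "b \<in> \<Union>Ch" for a b
    proof -
      from ab tot obtain I where "I \<in> Ch" "a \<in> I" "b \<in> I" by blast
      then show ?thesis using E(5) by blast
    qed
    show "a \<odot> b \<in> \<Union>Ch" if "a \<in> carrier K" "b \<in> \<Union>Ch" for a b using that E(4) by blast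
  qed
  then show ?thesis
    using Ch by (intro idealI[OF ring_axioms])
      (auto simp: submodule_def intro: ideal.I_l_closed ideal.I_r_closed)
qed

text \<open>A counterexample \<open>I\<close> enlarges to a maximal one \<open>P\<close>, which is
  prime, and nonzero because it contains \<open>I\<close>; this contradicts
  \<open>primes\<close>.\<close>

lemma fg_quotient_if_fg_prime_quotients:
  assumes aff: "affine_algebra K R"
    and primes: "\<And>P. \<lbrakk>nc_prime_ideal P R; P \<noteq> {\<zero>}\<rbrakk> \<Longrightarrow> fg_module K (quotient_algebra R P)"
    and I: "ideal I R" "I \<noteq> {\<zero>}"
  shows "fg_module K (quotient_algebra R I)"
proof (rule ccontr)
  assume nfg: "\<not> fg_module K (quotient_algebra R I)"
  define A where "A = {J. ideal J R \<and> I \<subseteq> J \<and> \<not> fg_module K (quotient_algebra R J)}"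
  have "\<exists>P\<in>A. \<forall>J\<in>A. P \<subseteq> J \<longrightarrow> J = P"
  proof (rule subset_Zorn_nonempty)
    show "A \<noteq> {}" using I nfg by (auto simp: A_def)
    fix Ch assume ne: "Ch \<noteq> {}" and ch: "subset.chain A Ch"
    have chI: "subset.chain {I. ideal I R} Ch"
      using ch by (auto simp: subset_chain_def A_def)
    have ChA: "Ch \<subseteq> A" using ch by (auto simp: subset_chain_def)
    have U: "ideal (\<Union>Ch) R" by (rule ideal_Union_chain[OF chI ne])
    \<comment> \<open>Finiteness of \<open>F\<close> is decisive: \<open>F\<close> fits into one
      member \<open>J\<close> of the chain, and then \<open>F R \<subseteq> J\<close> makes the
      quotient by \<open>J\<close> finitely generated.\<close>
    have "\<not> fg_module K (quotient_algebra R (\<Union>Ch))"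
    proof
      assume "fg_module K (quotient_algebra R (\<Union>Ch))"
      then obtain C F where C: "finite C" "C \<subseteq> carrier R" and F: "finite F" "F \<subseteq> \<Union>Ch"
        and gen: "\<And>H. \<lbrakk>submodule H K R; C \<subseteq> H; \<forall>x\<in>F. \<forall>r\<in>carrier R. x \<otimes> r \<in> H\<rbrakk> \<Longrightarrow> H = carrier R"
        by (rule affine_cofinite_spanned[OF aff U]) (rule that)
      obtain J where J: "J \<in> Ch" "F \<subseteq> J"
        by (rule finite_subset_Union_chain[OF F ne ch])
      then have JA: "J \<in> A" using ChA by blast
      then have Jid: "ideal J R" by (simp add: A_def)
      have "x \<otimes> r \<in> J" if "x \<in> F" "r \<in> carrier R" for x r
        using that J(2) by (intro ideal.I_r_closed[OF Jid]) auto
      then have "fg_module K (quotient_algebra R J)"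
        by (intro fg_quotientI[OF Jid C] gen) auto
      with JA show False by (simp add: A_def)
    qed
    then show "\<Union>Ch \<in> A" using U ChA ne by (auto simp: A_def)
  qed
  then obtain P where P: "P \<in> A" and max: "\<And>J. \<lbrakk>J \<in> A; P \<subseteq> J\<rbrakk> \<Longrightarrow> J = P" by blast
  have Pid: "ideal P R" and IP: "I \<subseteq> P" and nfgP: "\<not> fg_module K (quotient_algebra R P)"
    using P by (auto simp: A_def)
  \<comment> \<open>The sum of \<open>J\<close> and \<open>P\<close> is strictly larger than
    \<open>P\<close>, so by maximality it is outside \<open>A\<close>; it is an ideal above
    \<open>I\<close>, so its quotient must be finitely generated.\<close>
  have fg_sum: "ideal (J <+>\<^bsub>R\<^esub> P) R \<and> P \<subseteq> J <+>\<^bsub>R\<^esub> P \<and> fg_module K (quotient_algebra R (J <+>\<^bsub>R\<^esub> P))"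
    if J: "ideal J R" "\<not> J \<subseteq> P" for J
  proof -
    have id: "ideal (J <+>\<^bsub>R\<^esub> P) R" by (rule add_ideals[OF J(1) Pid])
    have "Idl (J \<union> P) = J <+>\<^bsub>R\<^esub> P" by (rule union_genideal[OF J(1) Pid])
    moreover have "J \<union> P \<subseteq> Idl (J \<union> P)"
      using ideal.Icarr[OF J(1)] ideal.Icarr[OF Pid] by (intro genideal_self) auto
    ultimately have "J \<subseteq> J <+>\<^bsub>R\<^esub> P" "P \<subseteq> J <+>\<^bsub>R\<^esub> P" by auto
    with id J(2) max[of "J <+>\<^bsub>R\<^esub> P"] IP show ?thesis by (auto simp: A_def)
  qed
  have "J1 \<subseteq> P \<or> J2 \<subseteq> P"
    if J1: "ideal J1 R" and J2: "ideal J2 R" and prod: "J1 \<cdot>\<^bsub>R\<^esub> J2 \<subseteq> P" for J1 J2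
  proof (rule ccontr)
    assume "\<not> (J1 \<subseteq> P \<or> J2 \<subseteq> P)"
    then have 1: "\<not> J1 \<subseteq> P" and 2: "\<not> J2 \<subseteq> P" by auto
    note s1 = fg_sum[OF J1 1] and s2 = fg_sum[OF J2 2]
    let ?S = "(J1 <+>\<^bsub>R\<^esub> P) \<cdot>\<^bsub>R\<^esub> (J2 <+>\<^bsub>R\<^esub> P)"
    interpret P: ideal P R by (rule Pid)
    \<comment> \<open>Expanding a product leaves a term in \<open>J1 J2\<close> and terms with a
      factor in \<open>P\<close>.\<close>
    have "?S \<subseteq> P"
    proof
      fix z assume "z \<in> ?S"
      then show "z \<in> P"
      proof (induct z rule: ideal_prod.induct)
        case (prod i j)
        then obtain a p b q where *: "i = a \<oplus> p" "a \<in> J1" "p \<in> P" "j = b \<oplus> q" "b \<in> J2" "q \<in> P"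
          by (auto simp: set_add_def')
        then have c: "a \<in> carrier R" "b \<in> carrier R" "p \<in> carrier R" "q \<in> carrier R"
          using ideal.Icarr[OF J1] ideal.Icarr[OF J2] P.Icarr by auto
        have "a \<otimes> b \<in> P" using * \<open>J1 \<cdot>\<^bsub>R\<^esub> J2 \<subseteq> P\<close> by (auto intro: ideal_prod.prod)
        moreover have "i \<otimes> j = a \<otimes> b \<oplus> (a \<otimes> q \<oplus> p \<otimes> (b \<oplus> q))"
          using * c by (simp add: l_distr r_distr a_ac)
        ultimately show ?case using * c by (simp add: P.I_l_closed P.I_r_closed)
      qed simp
    qed
    moreover have "fg_module K (quotient_algebra R ?S)"
      using fg_quotient_prod[OF aff] s1 s2 by blast
    ultimately have "fg_module K (quotient_algebra R P)"
      using fg_quotient_mono[OF ideal_prod_is_ideal Pid] s1 s2 by blast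
    with nfgP show False by contradiction
  qed
  moreover have "P \<noteq> carrier R" using nfgP fg_quotient_carrier by blast
  ultimately have "nc_prime_ideal P R" using Pid by (auto simp: nc_prime_ideal_def)
  moreover have "P \<noteq> {\<zero>}"
    using IP I additive_subgroup.zero_closed[OF ideal.axioms(1)[OF I(1)]] by blast
  ultimately show False using primes nfgP by blast
qed

end

theorem theorem4p17:
  fixes K :: "('k, 'm) ring_scheme" and R :: "('k, 'r, 'n) module_scheme"
  assumes "cring K" and "noetherian_ring K" and "affine_algebra K R"
  shows "satisfies_P1 R (cofinite_ideals K R)
    \<and> (\<forall>S :: ('k, 's, 'q) module_scheme. just_infinite K S \<longrightarrow> prime_ring S)
    \<and> (\<not> fg_module K R \<longrightarrow>
         (just_infinite K R \<longleftrightarrow>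
           (\<forall>P. nc_prime_ideal P R \<and> P \<noteq> {\<zero>\<^bsub>R\<^esub>} \<longrightarrow> fg_module K (quotient_algebra R P))))"
proof (intro conjI allI impI)
  have alg: "assoc_algebra K R" using assms(3) by (simp add: affine_algebra_def)
  then interpret assoc_algebra K R .
  show "satisfies_P1 R (cofinite_ideals K R)"
    using assms(3) by (rule cofinite_ideals_satisfies_P1)
  \<comment> \<open>\<open>S\<close> is an arbitrary algebra with its own carrier type, so the lemma
    is used in its exported form rather than through the interpretation at \<open>R\<close>.\<close>
  show "prime_ring S" if "just_infinite K S" for S :: "('k, 's, 'q) module_scheme"
    using that assoc_algebra.just_infinite_imp_prime_ring by (auto simp: just_infinite_def)
  show "just_infinite K R \<longleftrightarrow>
      (\<forall>P. nc_prime_ideal P R \<and> P \<noteq> {\<zero>\<^bsub>R\<^esub>} \<longrightarrow> fg_module K (quotient_algebra R P))"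
    (is "_ \<longleftrightarrow> ?primes") if nfg: "\<not> fg_module K R"
  proof
    show ?primes if "just_infinite K R"
      using that unfolding just_infinite_def nc_prime_ideal_def by simp
    show "just_infinite K R" if ?primes
      using alg nfg that fg_quotient_if_fg_prime_quotients[OF assms(3)]
      unfolding just_infinite_def by simp
  qed
qed

end
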